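(* Let $X\in\mathbb{R}^{n\times p}$ be a given matrix, let $\mathcal{T}\subset\{1,\dots,p\}$ with $|\mathcal{T}|=k$, let $\beta\in\mathbb{R}^p$ have support $\mathcal{T}$, and let $y=X\beta+\epsilon=X_{\mathcal{T}}\beta_{\mathcal{T}}+\epsilon$ with $\epsilon\sim\mathcal{N}(0,I_{n\times n})$. Let $$\hat\beta=\mathop{\rm arg\,min}_{|\mathrm{support}(\theta)|=k}\|y-X\theta\|^2 .$$ Let $\mathcal{F}\subset\{1,\dots,p\}$ with $|\mathcal{F}|=k$, $\mathcal{F}\neq\mathcal{T}$, and $X_{\mathcal{F}}^TX_{\mathcal{F}}$ invertible. Then the conditional probability that the decoder declares $\mathcal{F}$ when $\mathcal{T}$ is the true sparsity pattern satisfies $$\Pr[\mathcal{S}(\hat\beta)=\mathcal{F}\mid X,\beta,\mathcal{T}]\le \exp\left(-c\,\|(I-\Pi_{\mathcal{F}})X_{\mathcal{T}-\mathcal{F}}\beta_{\mathcal{T}-\mathcal{F}}\|^2+\frac{d}{2}\right),$$ where $c=\frac{3-2\sqrt2}{2}$, $d=|\mathcal{T}-\mathcal{F}|$ and $\Pi_{\mathcal{F}}=X_{\mathcal{F}}(X_{\mathcal{F}}^TX_{\mathcal{F}})^{-1}X_{\mathcal{F}}^T$.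
   Context: All norms are $\ell_2$. For a set $\mathcal{A}\subset\{1,\dots,p\}$, $X_{\mathcal{A}}$ is the $n\times|\mathcal{A}|$ matrix formed by the columns of $X$ with indices in $\mathcal{A}$, and $\beta_{\mathcal{A}}$ is the vector of entries of $\beta$ with indices in $\mathcal{A}$. $\mathcal{T}-\mathcal{F}$ is the set of elements of $\mathcal{T}$ not in $\mathcal{F}$. $\mathcal{S}(\theta)$ denotes the support (sparsity pattern) of $\theta$, i.e. the set of indices of its nonzero entries. The parameter $\beta$ is deterministic and $k$ is known to the decoder. The decoder's declared pattern is $\mathcal{S}(\hat\beta)=\hat{\mathcal{T}}(y,X)=\mathop{\rm arg\,min}_{|\mathcal{G}|=k}\|y-\Pi_{\mathcal{G}}y\|^2$, where $\Pi_{\mathcal{G}}$ is the orthogonal projection onto the column space of $X_{\mathcal{G}}$. *)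

theory Defs
  imports "HOL-Probability.Probability"
begin

definition supp_vec :: "real^'p \<Rightarrow> 'p set" where
  "supp_vec \<theta> = {j. \<theta> $ j \<noteq> 0}"

text \<open>
  The submatrix \<open>X\<^sub>A\<close> has a column type \<open>'k\<close> with as many elements as the index set \<open>A\<close>;
  its columns are listed along an arbitrarily chosen bijection from \<open>'k\<close> onto \<open>A\<close>. All of
  these notions are meaningful only if \<open>CARD('k) = card A\<close>. The order of the columns affects
  neither the invertibility of the Gram matrix, nor the projection onto the column space, nor
  the product \<open>X\<^sub>A \<beta>\<^sub>A\<close> (both factors use the same enumeration).
\<close>

definition enum_of :: "'p set \<Rightarrow> 'k::finite \<Rightarrow> 'p" where
  "enum_of A = (SOME \<sigma>. bij_betw \<sigma> UNIV A)"

definition cols_at :: "real^'p^'n \<Rightarrow> 'p set \<Rightarrow> real^'k^'n" where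
  "cols_at X A = (\<chi> i j. X $ i $ enum_of A j)"

definition entries_at :: "real^'p \<Rightarrow> 'p set \<Rightarrow> real^'k" where
  "entries_at \<beta> A = (\<chi> j. \<beta> $ enum_of A j)"

lemma bij_betw_enum_of:
  fixes A :: "'p::finite set"
  assumes "CARD('k::finite) = card A"
  shows "bij_betw (enum_of A :: 'k \<Rightarrow> 'p) UNIV A"
proof -
  have "\<exists>\<sigma> :: 'k \<Rightarrow> 'p. bij_betw \<sigma> UNIV A"
    using assms by (intro finite_same_card_bij) auto
  then show ?thesis
    unfolding enum_of_def by (rule someI_ex)
qed

lemma cols_at_mult_entries_at:
  fixes X :: "real^'p::finite^'n::finite"
  assumes "CARD('k::finite) = card A"
  shows "(cols_at X A :: real^'k^'n) *v entries_at \<beta> A = (\<Sum>j\<in>A. \<beta> $ j *\<^sub>R column j X)"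
proof (subst vec_eq_iff, intro allI)
  fix i
  have "((cols_at X A :: real^'k^'n) *v entries_at \<beta> A) $ i
      = (\<Sum>j\<in>(UNIV :: 'k set). X $ i $ enum_of A j * \<beta> $ enum_of A j)"
    by (simp add: matrix_vector_mult_def cols_at_def entries_at_def)
  also have "\<dots> = (\<Sum>j\<in>A. X $ i $ j * \<beta> $ j)"
    using bij_betw_enum_of[OF assms] by (rule sum.reindex_bij_betw)
  finally show "((cols_at X A :: real^'k^'n) *v entries_at \<beta> A) $ i
      = (\<Sum>j\<in>A. \<beta> $ j *\<^sub>R column j X) $ i"
    by (simp add: column_def mult.commute)
qed

text \<open>The matrix \<open>A (A\<^sup>T A)\<^sup>-\<^sup>1 A\<^sup>T\<close>; \<open>matrix_inv\<close> is unspecified unless \<open>A\<^sup>T A\<close> is invertible.\<close>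

definition col_proj :: "real^'k^'n \<Rightarrow> real^'n^'n" where
  "col_proj A = A ** matrix_inv (transpose A ** A) ** transpose A"

definition l0_minimizers :: "real^'p^'n \<Rightarrow> nat \<Rightarrow> real^'n \<Rightarrow> (real^'p) set" where
  "l0_minimizers X k y =
     {\<theta>. is_arg_min (\<lambda>\<theta>. (norm (y - X *v \<theta>))\<^sup>2) (\<lambda>\<theta>. card (supp_vec \<theta>) = k) \<theta>}"

text \<open>
  The minimizer need not be unique, and as the vectors with exactly \<open>k\<close> nonzero entries do
  not form a closed set, for some \<open>y\<close> (for instance \<open>y = 0\<close> when the columns of \<open>X\<close> are
  linearly independent and \<open>k > 0\<close>) there is none. A decoder may break ties in any way, and it
  is unconstrained at those \<open>y\<close> for which no minimizer exists.
\<close>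

definition l0_decoder :: "real^'p^'n \<Rightarrow> nat \<Rightarrow> (real^'n \<Rightarrow> real^'p) \<Rightarrow> bool" where
  "l0_decoder X k bhat \<longleftrightarrow>
     bhat \<in> borel_measurable borel \<and>
     (\<forall>y. l0_minimizers X k y \<noteq> {} \<longrightarrow> bhat y \<in> l0_minimizers X k y)"

definition std_normal_vec_density :: "real^'n \<Rightarrow> real" where
  "std_normal_vec_density z = (\<Prod>i\<in>UNIV. std_normal_density (z $ i))"

end

theory Submission
  imports Defs
begin

text \<open>
  Write \<open>\<epsilon> = z\<close>, let \<open>V\<close> and \<open>V\<^sub>0 \<subseteq> V\<close> be the column spaces of \<open>F\<close> and \<open>T \<inter> F\<close>, and let
  \<open>w\<close> be the component of \<open>X \<beta>\<close> orthogonal to \<open>V\<close>. Competing against the vectors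
  \<open>\<beta> + \<tau>\<close> with \<open>\<tau>\<close> supported in \<open>T \<inter> F\<close>, a decoder that declares \<open>F\<close> must satisfy
  \<open>norm w\<^sup>2 + 2 (w \<bullet> z) \<le> norm (P z)\<^sup>2\<close>, where \<open>P\<close> projects onto the orthogonal complement of
  \<open>V\<^sub>0\<close> in \<open>V\<close>, a space of dimension \<open>d\<close> that is orthogonal to \<open>w\<close>. So \<open>w \<bullet> z\<close> and \<open>P z\<close>
  are independent, and the Chernoff bound with parameter \<open>1/4\<close> gives
  \<open>exp (- norm w\<^sup>2 / 8) * 2 powr (d / 2)\<close>, which is below the claimed bound.

  The decoder is unconstrained where no minimizer with exactly \<open>k\<close> nonzero entries exists.
  This only happens on a finite union of hyperplanes, hence with probability \<open>0\<close>: a least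
  squares solution over \<open>card (supp_vec \<theta>) \<le> k\<close> whose support is as large as possible has fewer
  than \<open>k\<close> nonzero entries only if \<open>y\<close> is orthogonal to the nonzero residual of some column
  after projection onto other columns.
\<close>

section \<open>Gaussian integrals\<close>

lemma nn_integral_lborel_vec_prod:
  fixes f :: "'n::finite \<Rightarrow> real \<Rightarrow> real"
  assumes [measurable]: "\<And>i. f i \<in> borel_measurable borel" and nonneg: "\<And>i x. 0 \<le> f i x"
  shows "(\<integral>\<^sup>+ z. ennreal (\<Prod>i\<in>UNIV. f i ((z :: real^'n) $ i)) \<partial>lborel)
    = (\<Prod>i\<in>UNIV. \<integral>\<^sup>+ x. ennreal (f i x) \<partial>lborel)"
proof -
  define ix :: "real^'n \<Rightarrow> 'n" where "ix = inv (\<lambda>i. axis i 1)"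
  have inj: "inj (\<lambda>i::'n. axis i (1::real))"
    by (auto simp: inj_on_def axis_eq_axis)
  have ix [simp]: "ix (axis i 1) = i" for i
    unfolding ix_def using inj by (rule inv_f_f)
  have bij: "bij_betw (\<lambda>i. axis i 1) (UNIV :: 'n set) (Basis :: (real^'n) set)"
    using inj by (auto simp: bij_betw_def Basis_vec_def)
  have "(\<integral>\<^sup>+ z. ennreal (\<Prod>i\<in>UNIV. f i ((z :: real^'n) $ i)) \<partial>lborel)
      = (\<integral>\<^sup>+ z. (\<Prod>b\<in>Basis. ennreal (f (ix b) ((z :: real^'n) \<bullet> b))) \<partial>lborel)"
    by (subst prod.reindex_bij_betw[OF bij, symmetric])
       (simp add: prod_ennreal nonneg inner_axis)
  also have "\<dots> = (\<Prod>b\<in>(Basis :: (real^'n) set). \<integral>\<^sup>+ x. ennreal (f (ix b) x) \<partial>lborel)"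
    by (rule nn_integral_lborel_prod) auto
  also have "\<dots> = (\<Prod>i\<in>UNIV. \<integral>\<^sup>+ x. ennreal (f i x) \<partial>lborel)"
    by (subst prod.reindex_bij_betw[OF bij, symmetric]) simp
  finally show ?thesis .
qed

lemma borel_measurable_std_normal_vec_density [measurable]:
  "std_normal_vec_density \<in> borel_measurable (borel :: (real^'n::finite) measure)"
  unfolding std_normal_vec_density_def[abs_def] by measurable

lemma std_normal_vec_density_nonneg: "0 \<le> std_normal_vec_density z"
  unfolding std_normal_vec_density_def by (intro prod_nonneg) simp

lemma nn_integral_normal_density:
  "\<sigma> > 0 \<Longrightarrow> (\<integral>\<^sup>+ x. ennreal (normal_density \<mu> \<sigma> x) \<partial>lborel) = 1"
  by (simp add: nn_integral_eq_integral)

lemma power2_norm_vec: "(norm (z :: real^'n::finite))\<^sup>2 = (\<Sum>i\<in>UNIV. (z $ i)\<^sup>2)"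
  by (simp add: norm_vec_def L2_set_def sum_nonneg)

lemma std_normal_vec_mgf:
  fixes a :: "real^'n::finite"
  shows "(\<integral>\<^sup>+ z. ennreal (std_normal_vec_density z) * ennreal (exp (a \<bullet> z)) \<partial>lborel)
    = ennreal (exp ((norm a)\<^sup>2 / 2))"
proof -
  have shift: "std_normal_density x * exp (b * x) = exp (b\<^sup>2 / 2) * normal_density b 1 x" for b x
    by (simp add: normal_density_def mult_exp_exp power2_eq_square field_simps)
  have one_dim: "(\<integral>\<^sup>+ x. ennreal (std_normal_density x * exp (b * x)) \<partial>lborel)
      = ennreal (exp (b\<^sup>2 / 2))" for b
    by (simp add: shift ennreal_mult nn_integral_cmult nn_integral_normal_density)
  have "(\<integral>\<^sup>+ z. ennreal (std_normal_vec_density z) * ennreal (exp (a \<bullet> z)) \<partial>lborel)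
      = (\<integral>\<^sup>+ z. ennreal (\<Prod>i\<in>UNIV. std_normal_density (z $ i) * exp (a $ i * z $ i)) \<partial>lborel)"
    by (intro nn_integral_cong)
       (simp add: std_normal_vec_density_def prod.distrib inner_vec_def exp_sum ennreal_mult prod_nonneg)
  also have "\<dots> = (\<Prod>i\<in>UNIV. \<integral>\<^sup>+ x. ennreal (std_normal_density x * exp (a $ i * x)) \<partial>lborel)"
    by (rule nn_integral_lborel_vec_prod) auto
  also have "\<dots> = ennreal (exp ((norm a)\<^sup>2 / 2))"
    by (simp add: one_dim prod_ennreal exp_sum[symmetric] power2_norm_vec sum_divide_distrib)
  finally show ?thesis .
qed

text \<open>Multiplying by \<open>exp (x\<^sup>2 / 4)\<close> halves the quadratic exponent and so
  gives the shape of a normal density of variance 2; the new normalising constant costs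
  \<open>sqrt 2\<close> per coordinate.\<close>

lemma std_normal_vec_exp_norm_sq:
  "(\<integral>\<^sup>+ z. ennreal (std_normal_vec_density (z :: real^'n::finite))
      * ennreal (exp ((norm z)\<^sup>2 / 4)) \<partial>lborel) = ennreal (sqrt 2 ^ CARD('n))"
proof -
  have rescale: "std_normal_density x * exp (x\<^sup>2 / 4) = sqrt 2 * normal_density 0 (sqrt 2) x" for x
    by (simp add: normal_density_def mult_exp_exp real_sqrt_mult field_simps)
  have one_dim: "(\<integral>\<^sup>+ x. ennreal (std_normal_density x * exp (x\<^sup>2 / 4)) \<partial>lborel) = ennreal (sqrt 2)"
    by (simp add: rescale ennreal_mult nn_integral_cmult nn_integral_normal_density)
  have "(\<integral>\<^sup>+ z. ennreal (std_normal_vec_density (z :: real^'n))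
      * ennreal (exp ((norm z)\<^sup>2 / 4)) \<partial>lborel)
      = (\<integral>\<^sup>+ z. ennreal (\<Prod>i\<in>UNIV. std_normal_density ((z :: real^'n) $ i) * exp ((z $ i)\<^sup>2 / 4)) \<partial>lborel)"
    by (intro nn_integral_cong)
       (simp add: std_normal_vec_density_def prod.distrib power2_norm_vec
        exp_sum sum_divide_distrib ennreal_mult prod_nonneg)
  also have "\<dots> = (\<Prod>i\<in>(UNIV :: 'n set). \<integral>\<^sup>+ x. ennreal (std_normal_density x * exp (x\<^sup>2 / 4)) \<partial>lborel)"
    by (rule nn_integral_lborel_vec_prod) auto
  also have "\<dots> = ennreal (sqrt 2 ^ CARD('n))"
    by (simp add: one_dim ennreal_power)
  finally show ?thesis .
qed

text \<open>
  The quadratic exponent is linearised by a second Gaussian vector \<open>g\<close>, since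
  \<open>exp (norm h\<^sup>2 / 4) = E (exp (h \<bullet> g / sqrt 2))\<close> with \<open>h = adjoint U z\<close>, whose norm is
  that of the projection of \<open>z\<close> onto the range of \<open>U\<close>; Fubini then reduces the
  integral to moment generating functions, and no change of coordinates is needed.
\<close>

lemma std_normal_vec_exp_projection:
  fixes U :: "real^'d::finite \<Rightarrow> real^'n::finite" and w :: "real^'n"
  assumes U: "linear U" and iso: "\<And>g. norm (U g) = norm g" and orth: "\<And>g. w \<bullet> U g = 0"
  shows "(\<integral>\<^sup>+ z. ennreal (std_normal_vec_density z)
        * ennreal (exp (((norm (adjoint U z))\<^sup>2 - (norm w)\<^sup>2 - 2 * (w \<bullet> z)) / 4)) \<partial>lborel)
    = ennreal (exp (- (norm w)\<^sup>2 / 8) * sqrt 2 ^ CARD('d))"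
proof -
  \<comment> \<open>\<open>a g\<close> collects all that multiplies \<open>z\<close> in the
    exponent: the \<open>g\<close> term from the linearisation and the \<open>w\<close> term from
    the Chernoff parameter 1/4.\<close>
  define a where "a g = (1 / sqrt 2) *\<^sub>R U g - (1 / 2) *\<^sub>R w" for g
  define D :: "real^'d \<Rightarrow> real^'n \<Rightarrow> ennreal" where
    "D g z = ennreal (exp (- (norm w)\<^sup>2 / 4)) * ennreal (std_normal_vec_density g)
        * (ennreal (std_normal_vec_density z) * ennreal (exp (a g \<bullet> z)))" for g z
  have [measurable]: "U \<in> borel_measurable borel"
    using U by (intro borel_measurable_continuous_onI linear_continuous_on)
      (simp add: linear_conv_bounded_linear)
  have a_inner: "a g \<bullet> z = ((1 / sqrt 2) *\<^sub>R adjoint U z) \<bullet> g - (w \<bullet> z) / 2" for g z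
    by (simp add: a_def inner_diff_left adjoint_clauses[OF U]) (simp add: inner_commute)
  \<comment> \<open>Orthogonality of \<open>w\<close> to the range of \<open>U\<close> removes the
    cross term. Half of this is \<open>(norm g)\<^sup>2 / 4 + (norm w)\<^sup>2 / 8\<close>, which
    together with the prefactor \<open>exp (- (norm w)\<^sup>2 / 4)\<close> leaves
    \<open>exp (- (norm w)\<^sup>2 / 8)\<close>.\<close>
  have norm_a: "(norm (a g))\<^sup>2 = (norm g)\<^sup>2 / 2 + (norm w)\<^sup>2 / 4" for g
  proof -
    have "U g \<bullet> U g = g \<bullet> g"
      using iso[of g] by (simp add: norm_eq)
    then show ?thesis
      using orth[of g]
      by (simp add: a_def power2_norm_eq_inner inner_diff_left inner_diff_right inner_commute field_simps)
  qed
  have "(\<integral>\<^sup>+ z. ennreal (std_normal_vec_density z)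
        * ennreal (exp (((norm (adjoint U z))\<^sup>2 - (norm w)\<^sup>2 - 2 * (w \<bullet> z)) / 4)) \<partial>lborel)
      = (\<integral>\<^sup>+ z. \<integral>\<^sup>+ g. D g z \<partial>lborel \<partial>lborel)"
  proof (rule nn_integral_cong)
    fix z :: "real^'n"
    define h where "h = (1 / sqrt 2) *\<^sub>R adjoint U z"
    have h: "(norm h)\<^sup>2 / 2 = (norm (adjoint U z))\<^sup>2 / 4"
      by (simp add: h_def power_divide)
    define C where "C = std_normal_vec_density z * exp (- (norm w)\<^sup>2 / 4 - (w \<bullet> z) / 2)"
    have C: "C \<ge> 0"
      by (simp add: C_def std_normal_vec_density_nonneg)
    have "(\<integral>\<^sup>+ g. D g z \<partial>lborel)
        = (\<integral>\<^sup>+ g. ennreal C * (ennreal (std_normal_vec_density g) * ennreal (exp (h \<bullet> g))) \<partial>lborel)"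
    proof (rule nn_integral_cong)
      fix g :: "real^'d"
      have exps: "exp (- (norm w)\<^sup>2 / 4) * exp (h \<bullet> g - (w \<bullet> z) / 2)
          = exp (- (norm w)\<^sup>2 / 4 - (w \<bullet> z) / 2) * exp (h \<bullet> g)"
        by (simp add: mult_exp_exp)
      show "D g z = ennreal C * (ennreal (std_normal_vec_density g) * ennreal (exp (h \<bullet> g)))"
        using exps by (simp add: D_def C_def a_inner h_def[symmetric] ennreal_mult[symmetric]
            std_normal_vec_density_nonneg mult.assoc mult.left_commute)
    qed
    also have "\<dots> = ennreal C * ennreal (exp ((norm h)\<^sup>2 / 2))"
      by (subst nn_integral_cmult) (simp_all add: std_normal_vec_mgf)
    also have "\<dots> = ennreal (std_normal_vec_density z)
        * ennreal (exp (((norm (adjoint U z))\<^sup>2 - (norm w)\<^sup>2 - 2 * (w \<bullet> z)) / 4))"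
      unfolding h C_def
      by (simp add: ennreal_mult[symmetric] std_normal_vec_density_nonneg mult.assoc
          mult_exp_exp diff_divide_distrib)
    finally show "ennreal (std_normal_vec_density z)
        * ennreal (exp (((norm (adjoint U z))\<^sup>2 - (norm w)\<^sup>2 - 2 * (w \<bullet> z)) / 4))
        = (\<integral>\<^sup>+ g. D g z \<partial>lborel)" ..
  qed
  also have "\<dots> = (\<integral>\<^sup>+ g. \<integral>\<^sup>+ z. D g z \<partial>lborel \<partial>lborel)"
    by (rule lborel_pair.Fubini') (simp add: D_def a_def)
  also have "\<dots> = (\<integral>\<^sup>+ g. ennreal (exp (- (norm w)\<^sup>2 / 8))
      * (ennreal (std_normal_vec_density (g :: real^'d)) * ennreal (exp ((norm g)\<^sup>2 / 4))) \<partial>lborel)"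
  proof (rule nn_integral_cong)
    fix g :: "real^'d"
    have "(\<integral>\<^sup>+ z. D g z \<partial>lborel)
        = ennreal (exp (- (norm w)\<^sup>2 / 4)) * ennreal (std_normal_vec_density g)
          * ennreal (exp ((norm (a g))\<^sup>2 / 2))"
      unfolding D_def by (subst nn_integral_cmult) (simp_all add: std_normal_vec_mgf)
    also have "\<dots> = ennreal (exp (- (norm w)\<^sup>2 / 8))
      * (ennreal (std_normal_vec_density g) * ennreal (exp ((norm g)\<^sup>2 / 4)))"
      by (simp add: norm_a ennreal_mult[symmetric] std_normal_vec_density_nonneg
          mult_exp_exp mult.left_commute add_divide_distrib)
    finally show "integral\<^sup>N lborel (D g) = ennreal (exp (- (norm w)\<^sup>2 / 8))
      * (ennreal (std_normal_vec_density g) * ennreal (exp ((norm g)\<^sup>2 / 4)))" .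
  qed
  also have "\<dots> = ennreal (exp (- (norm w)\<^sup>2 / 8) * sqrt 2 ^ CARD('d))"
    by (subst nn_integral_cmult) (simp_all add: std_normal_vec_exp_norm_sq ennreal_mult)
  finally show ?thesis .
qed

section \<open>Existence of sparse least squares solutions\<close>

text \<open>This is the span of the columns indexed by \<open>S\<close>. Writing it as the image of
  a coordinate subspace avoids a separate column type for each index set.\<close>

definition col_space :: "real^'p::finite^'n::finite \<Rightarrow> 'p set \<Rightarrow> (real^'n) set" where
  "col_space X S = (*v) X ` {\<theta>. supp_vec \<theta> \<subseteq> S}"

lemma subspace_supp_vec: "subspace {\<theta> :: real^'p::finite. supp_vec \<theta> \<subseteq> S}"
  by (auto simp: subspace_def supp_vec_def) force

lemma subspace_col_space: "subspace (col_space X S)"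
  unfolding col_space_def
  by (intro linear_subspace_image matrix_vector_mul_linear subspace_supp_vec)

lemma col_space_mono: "S \<subseteq> S' \<Longrightarrow> col_space X S \<subseteq> col_space X S'"
  unfolding col_space_def by blast

lemma mult_vec_in_col_space: "supp_vec \<theta> \<subseteq> S \<Longrightarrow> X *v \<theta> \<in> col_space X S"
  unfolding col_space_def by blast

lemma supp_vec_axis: "supp_vec (axis j 1) = {j}"
  by (auto simp: supp_vec_def axis_def)

lemma column_in_col_space: "j \<in> S \<Longrightarrow> column j X \<in> col_space X S"
  using mult_vec_in_col_space[of "axis j 1" S X] by (simp add: matrix_vector_mult_basis supp_vec_axis)

lemma orthogonal_decomp_subspace:
  fixes V :: "'a::euclidean_space set"
  assumes "subspace V"
  obtains u v where "u \<in> V" "\<And>x. x \<in> V \<Longrightarrow> v \<bullet> x = 0" "a = u + v"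
  using orthogonal_subspace_decomp_exists[of V a] assms
  by (metis orthogonal_def span_eq_iff)

text \<open>The best step along \<open>x\<close> lowers the squared norm by
  \<open>(r \<bullet> x)\<^sup>2 / (x \<bullet> x)\<close>, so minimality forces this quantity to
  vanish.\<close>

lemma inner_eq_0_if_norm_le:
  fixes r x :: "'a::real_inner"
  assumes "\<And>t. norm r \<le> norm (r - t *\<^sub>R x)"
  shows "r \<bullet> x = 0"
proof (cases "x = 0")
  case False
  define t where "t = (r \<bullet> x) / (x \<bullet> x)"
  have "r \<bullet> r \<le> (r - t *\<^sub>R x) \<bullet> (r - t *\<^sub>R x)"
    using assms[of t] by (simp add: norm_le)
  also have "\<dots> = r \<bullet> r - (r \<bullet> x)\<^sup>2 / (x \<bullet> x)"
    using False by (simp add: t_def inner_diff_left inner_diff_right inner_commute power2_eq_square)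
  finally have "(r \<bullet> x)\<^sup>2 / (x \<bullet> x) \<le> 0"
    by simp
  then show ?thesis
    using False by (auto simp: divide_le_0_iff dest: leD)
qed simp

section \<open>Least squares with at most \<open>k\<close> nonzero entries\<close>

text \<open>With at most \<open>k\<close> nonzero entries, instead of exactly \<open>k\<close>, the
  attainable \<open>X *v \<theta>\<close> form a finite union of closed subspaces, so a minimizer
  exists for every \<open>y\<close>.\<close>

definition sparse_ls :: "real^'p::finite^'n::finite \<Rightarrow> nat \<Rightarrow> real^'n \<Rightarrow> real^'p \<Rightarrow> bool" where
  "sparse_ls X k y \<theta> \<longleftrightarrow> card (supp_vec \<theta>) \<le> k \<and>
     (\<forall>\<theta>'. card (supp_vec \<theta>') \<le> k \<longrightarrow> norm (y - X *v \<theta>) \<le> norm (y - X *v \<theta>'))"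

lemma sparse_ls_exists:
  fixes X :: "real^'p::finite^'n::finite"
  obtains \<theta> where "sparse_ls X k y \<theta>"
proof -
  let ?U = "\<Union>S\<in>{S. card S \<le> k}. col_space X S"
  have U: "?U = (*v) X ` {\<theta>. card (supp_vec \<theta>) \<le> k}"
  proof (intro equalityI subsetI)
    fix u assume "u \<in> ?U"
    then obtain S \<theta> where "card S \<le> k" "supp_vec \<theta> \<subseteq> S" "u = X *v \<theta>"
      by (auto simp: col_space_def)
    then show "u \<in> (*v) X ` {\<theta>. card (supp_vec \<theta>) \<le> k}"
      using card_mono[OF finite, of "supp_vec \<theta>" S] by auto
  next
    fix u assume "u \<in> (*v) X ` {\<theta>. card (supp_vec \<theta>) \<le> k}"
    then show "u \<in> ?U"
      by (auto intro: mult_vec_in_col_space)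
  qed
  have "closed ?U"
    by (intro closed_UN closed_subspace subspace_col_space ballI) simp
  moreover have "?U \<noteq> {}"
    using subspace_0[OF subspace_col_space] by (metis UN_I card.empty empty_iff le0 mem_Collect_eq)
  ultimately obtain u where u: "u \<in> ?U" "\<And>v. v \<in> ?U \<Longrightarrow> dist y u \<le> dist y v"
    using distance_attains_inf by metis
  then show ?thesis
    using that unfolding U sparse_ls_def dist_norm by auto
qed

text \<open>A solution of maximal support with fewer than \<open>k\<close> entries has room for a
  further index \<open>j\<close>, so its residual is orthogonal to \<open>column j X\<close> as
  well. Either that column is independent of the support columns and \<open>y\<close> lies on an
  excluded hyperplane, or a kernel vector enlarges the support.\<close>

lemma generic_sparse_ls_full_support:
  fixes X :: "real^'p::finite^'n::finite"
  assumes k: "k \<le> CARD('p)"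
  obtains N where "finite N" "0 \<notin> N"
    "\<And>y. (\<And>v. v \<in> N \<Longrightarrow> v \<bullet> y \<noteq> 0) \<Longrightarrow> \<exists>\<theta>. sparse_ls X k y \<theta> \<and> card (supp_vec \<theta>) = k"
proof -
  have "\<exists>v. (\<forall>x\<in>col_space X S. v \<bullet> x = 0) \<and> column j X - v \<in> col_space X S" for S j
    by (rule orthogonal_decomp_subspace[OF subspace_col_space[of X S], of "column j X"])
       (metis add_diff_cancel_right')
  then obtain v where v_orth: "\<And>S j x. x \<in> col_space X S \<Longrightarrow> v S j \<bullet> x = 0"
    and v_diff: "\<And>S j. column j X - v S j \<in> col_space X S"
    by metis
  \<comment> \<open>A zero residual, which arises from a dependent column, would exclude every
    \<open>y\<close>; dependent columns are handled by the kernel vector instead.\<close>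
  define N where "N = range (case_prod v) - {0}"
  have "\<exists>\<theta>. sparse_ls X k y \<theta> \<and> card (supp_vec \<theta>) = k"
    if y: "\<And>v. v \<in> N \<Longrightarrow> v \<bullet> y \<noteq> 0" for y
  proof -
    obtain \<theta> where \<theta>: "sparse_ls X k y \<theta>"
      and maximal: "\<And>\<theta>'. sparse_ls X k y \<theta>' \<Longrightarrow> card (supp_vec \<theta>') \<le> card (supp_vec \<theta>)"
    proof -
      obtain \<theta>0 where "sparse_ls X k y \<theta>0"
        by (rule sparse_ls_exists)
      then show ?thesis
        using ex_has_greatest_nat[of "sparse_ls X k y" \<theta>0 "\<lambda>\<theta>. card (supp_vec \<theta>)" "Suc k"] that
        by (auto simp: sparse_ls_def)
    qed
    have "card (supp_vec \<theta>) = k"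
    proof (rule ccontr)
      assume "card (supp_vec \<theta>) \<noteq> k"
      then have less: "card (supp_vec \<theta>) < k"
        using \<theta> by (simp add: sparse_ls_def)
      then have "supp_vec \<theta> \<noteq> UNIV"
        using k by auto
      then obtain j where j: "j \<notin> supp_vec \<theta>"
        by auto
      let ?S = "supp_vec \<theta>" and ?S' = "insert j (supp_vec \<theta>)"
      have min: "norm (y - X *v \<theta>) \<le> norm (y - X *v \<theta>')" if "supp_vec \<theta>' \<subseteq> ?S'" for \<theta>'
      proof -
        have "card (supp_vec \<theta>') \<le> card ?S'"
          by (rule card_mono) (use that in auto)
        then show ?thesis
          using \<theta> less j by (simp add: sparse_ls_def)
      qed
      have resid: "(y - X *v \<theta>) \<bullet> x = 0" if "x \<in> col_space X ?S'" for x
      proof (rule inner_eq_0_if_norm_le)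
        fix t
        obtain \<eta> where \<eta>: "supp_vec \<eta> \<subseteq> ?S'" "x = X *v \<eta>"
          using \<open>x \<in> _\<close> by (auto simp: col_space_def)
        have "supp_vec (\<theta> + t *\<^sub>R \<eta>) \<subseteq> ?S'"
          using \<eta>(1) by (auto simp: supp_vec_def)
        from min[OF this] show "norm (y - X *v \<theta>) \<le> norm (y - X *v \<theta> - t *\<^sub>R x)"
          by (simp add: \<eta>(2) matrix_vector_right_distrib matrix_vector_mult_scaleR algebra_simps)
      qed
      show False
      proof (cases "v ?S j = 0")
        case False
        \<comment> \<open>This puts \<open>v ?S j\<close> in the larger column space, so the
          residual is orthogonal to it; \<open>X *v \<theta>\<close> is too, hence so is
          \<open>y\<close>.\<close>
        have "column j X - (column j X - v ?S j) \<in> col_space X ?S'"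
          using v_diff[where S="?S" and j=j] col_space_mono[of ?S ?S' X]
          by (intro subspace_diff[OF subspace_col_space _ subsetD] column_in_col_space) auto
        then have "(y - X *v \<theta>) \<bullet> v ?S j = 0"
          by (intro resid) simp
        then have "v ?S j \<bullet> y = 0"
          using v_orth[OF mult_vec_in_col_space[OF subset_refl, of X \<theta>], of j]
          by (simp add: inner_diff_left inner_diff_right inner_commute)
        moreover have "v ?S j \<in> N"
          using False unfolding N_def by force
        ultimately show False
          using y by blast
      next
        case True
        then have "column j X \<in> col_space X ?S"
          using v_diff[where S="?S" and j=j] by simp
        then obtain \<eta> where \<eta>: "supp_vec \<eta> \<subseteq> ?S" "column j X = X *v \<eta>"
          by (auto simp: col_space_def)
        define \<kappa> where "\<kappa> = axis j 1 - \<eta>"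
        have ker: "X *v \<kappa> = 0"
          by (simp add: \<kappa>_def matrix_vector_mult_diff_distrib matrix_vector_mult_basis \<eta>(2))
        have \<kappa>: "\<kappa> $ j = 1" "supp_vec \<kappa> \<subseteq> ?S'"
          using \<eta>(1) j by (auto simp: \<kappa>_def supp_vec_def axis_def split: if_splits)
        \<comment> \<open>Moving along the kernel vector \<open>\<kappa>\<close> keeps \<open>X *v \<theta>\<close> and, for all but finitely many step
          sizes, enlarges the support.\<close>
        obtain t where t: "t \<notin> insert 0 (range (\<lambda>i. - (\<theta> $ i / \<kappa> $ i)))"
          using ex_new_if_finite[OF infinite_UNIV_char_0,
              of "insert 0 (range (\<lambda>i. - (\<theta> $ i / \<kappa> $ i)))"]
          by auto
        have "supp_vec (\<theta> + t *\<^sub>R \<kappa>) = ?S'"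
        proof (intro equalityI subsetI)
          fix i assume "i \<in> supp_vec (\<theta> + t *\<^sub>R \<kappa>)"
          then show "i \<in> ?S'"
            using \<kappa>(2) by (auto simp: supp_vec_def)
        next
          fix i assume i: "i \<in> ?S'"
          show "i \<in> supp_vec (\<theta> + t *\<^sub>R \<kappa>)"
          proof (cases "i = j")
            case True
            then show ?thesis
              using t \<kappa>(1) j by (simp add: supp_vec_def)
          next
            case False
            then have "\<theta> $ i \<noteq> 0"
              using i by (simp add: supp_vec_def)
            moreover have "t = - (\<theta> $ i / \<kappa> $ i)" if "\<theta> $ i + t * \<kappa> $ i = 0" "\<kappa> $ i \<noteq> 0"
              using that by (simp add: field_simps)
            ultimately show ?thesis
              using t by (cases "\<kappa> $ i = 0") (auto simp: supp_vec_def)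
          qed
        qed
        moreover have "X *v (\<theta> + t *\<^sub>R \<kappa>) = X *v \<theta>"
          by (simp add: matrix_vector_right_distrib matrix_vector_mult_scaleR ker)
        ultimately have "sparse_ls X k y (\<theta> + t *\<^sub>R \<kappa>)" "card (supp_vec (\<theta> + t *\<^sub>R \<kappa>)) = Suc (card ?S)"
          using \<theta> less j by (simp_all add: sparse_ls_def)
        then show False
          using maximal by fastforce
      qed
    qed
    then show ?thesis
      using \<theta> by blast
  qed
  moreover have "finite N" "0 \<notin> N"
    by (simp_all add: N_def)
  ultimately show ?thesis
    using that by blast
qed

lemma AE_lborel_inner_neq:
  fixes v :: "'a::euclidean_space"
  assumes "v \<noteq> 0"
  shows "AE z in lborel. v \<bullet> z \<noteq> c"
proof -
  have "{z. v \<bullet> z = c} \<in> null_sets lebesgue"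
    using assms negligible_hyperplane[of v c] by (simp add: negligible_iff_null_sets)
  then have "AE z in lebesgue. z \<notin> {z. v \<bullet> z = c}"
    by (rule AE_not_in)
  then show ?thesis
    by (simp add: AE_completion_iff)
qed

lemma AE_sparse_ls_full_support:
  fixes X :: "real^'p::finite^'n::finite"
  assumes "k \<le> CARD('p)"
  shows "AE z in lborel. \<exists>\<theta>. sparse_ls X k (b + z) \<theta> \<and> card (supp_vec \<theta>) = k"
proof -
  obtain N where N: "finite N" "0 \<notin> N"
    and full: "\<And>y. (\<And>v. v \<in> N \<Longrightarrow> v \<bullet> y \<noteq> 0) \<Longrightarrow> \<exists>\<theta>. sparse_ls X k y \<theta> \<and> card (supp_vec \<theta>) = k"
    using generic_sparse_ls_full_support[OF assms] by metis
  have "AE z in lborel. v \<bullet> z \<noteq> - (v \<bullet> b)" if "v \<in> N" for v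
    using N(2) that by (intro AE_lborel_inner_neq) auto
  then have "AE z in lborel. \<forall>v\<in>N. v \<bullet> z \<noteq> - (v \<bullet> b)"
    using N(1) by (simp add: AE_finite_all)
  then show ?thesis
    by eventually_elim (intro full, auto simp: inner_add_right)
qed

text \<open>The vector \<open>\<theta>\<close> shows that minimizing over exactly \<open>k\<close>
  and over at most \<open>k\<close> nonzero entries gives the same minimum at \<open>y\<close>. It
  also witnesses that a minimizer exists there, which is what binds the decoder.\<close>

lemma sparse_ls_decoder:
  assumes "sparse_ls X k y \<theta>" "card (supp_vec \<theta>) = k" and dec: "l0_decoder X k bhat"
  shows "sparse_ls X k y (bhat y)"
proof -
  have "\<theta> \<in> l0_minimizers X k y"
    using assms(1,2) by (auto simp: l0_minimizers_def is_arg_min_linorder sparse_ls_def power_mono)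
  then have "bhat y \<in> l0_minimizers X k y"
    using dec unfolding l0_decoder_def by blast
  then have "card (supp_vec (bhat y)) = k" "norm (y - X *v bhat y) \<le> norm (y - X *v \<theta>)"
    using assms(2) by (auto simp: l0_minimizers_def is_arg_min_linorder)
  then show ?thesis
    using assms(1) unfolding sparse_ls_def by (metis order.refl order.trans)
qed

section \<open>Geometry of the error event\<close>

lemma entries_at_surj:
  fixes c :: "real^'k::finite" and F :: "'p::finite set"
  assumes "CARD('k) = card F"
  obtains \<theta> where "supp_vec \<theta> \<subseteq> F" "entries_at \<theta> F = c"
proof
  let ?\<sigma> = "enum_of F :: 'k \<Rightarrow> 'p"
  let ?\<theta> = "\<chi> i. if i \<in> F then c $ inv ?\<sigma> i else 0"
  have "inj ?\<sigma>" "range ?\<sigma> = F"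
    using bij_betw_enum_of[OF assms] by (auto simp: bij_betw_def)
  then show "entries_at ?\<theta> F = c"
    by (auto simp: entries_at_def vec_eq_iff)
  show "supp_vec ?\<theta> \<subseteq> F"
    by (auto simp: supp_vec_def)
qed

lemma cols_at_mult_entries_at_supp:
  fixes X :: "real^'p::finite^'n::finite"
  assumes "CARD('k::finite) = card F" "supp_vec \<theta> \<subseteq> F"
  shows "(cols_at X F :: real^'k^'n) *v entries_at \<theta> F = X *v \<theta>"
proof -
  have "(\<Sum>j\<in>F. \<theta> $ j *\<^sub>R column j X) = (\<Sum>j\<in>UNIV. \<theta> $ j *\<^sub>R column j X)"
    using assms(2) by (intro sum.mono_neutral_left) (auto simp: supp_vec_def)
  then show ?thesis
    by (simp add: cols_at_mult_entries_at[OF assms(1)] matrix_mult_sum[of X] scalar_mult_eq_scaleR)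
qed

lemma range_cols_at:
  fixes X :: "real^'p::finite^'n::finite"
  assumes "CARD('k::finite) = card F"
  shows "range ((*v) (cols_at X F :: real^'k^'n)) = col_space X F"
proof (intro equalityI subsetI)
  fix x assume "x \<in> range ((*v) (cols_at X F :: real^'k^'n))"
  then obtain c where x: "x = (cols_at X F :: real^'k^'n) *v c"
    by auto
  obtain \<theta> where "supp_vec \<theta> \<subseteq> F" "entries_at \<theta> F = c"
    using entries_at_surj[OF assms] .
  then show "x \<in> col_space X F"
    using cols_at_mult_entries_at_supp[OF assms, of \<theta> X] by (auto simp: x col_space_def)
next
  fix x assume "x \<in> col_space X F"
  then obtain \<theta> where "supp_vec \<theta> \<subseteq> F" "x = X *v \<theta>"
    by (auto simp: col_space_def)
  then show "x \<in> range ((*v) (cols_at X F :: real^'k^'n))"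
    using cols_at_mult_entries_at_supp[OF assms, of \<theta> X] by (metis rangeI)
qed

lemma matrix_inv_invertible:
  fixes A :: "real^'k::finite^'k"
  assumes "invertible A"
  shows "A ** matrix_inv A = mat 1" "matrix_inv A ** A = mat 1"
  using someI_ex[OF assms[unfolded invertible_def]] by (simp_all add: matrix_inv_def)

lemma inj_if_invertible_gram:
  fixes A :: "real^'k::finite^'n::finite"
  assumes "invertible (transpose A ** A)"
  shows "inj ((*v) A)"
proof (rule injI)
  let ?G = "transpose A ** A"
  fix x y assume "A *v x = A *v y"
  then have "matrix_inv ?G *v (transpose A *v (A *v x)) = matrix_inv ?G *v (transpose A *v (A *v y))"
    by simp
  then show "x = y"
    using matrix_inv_invertible(2)[OF assms]
    by (simp add: matrix_vector_mul_assoc matrix_mul_assoc)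
qed

text \<open>The Gram matrix cancels its inverse in \<open>transpose A ** col_proj A\<close>, which
  leaves \<open>transpose A\<close>; so residuals lie in the kernel of
  \<open>transpose A\<close>.\<close>

lemma col_proj_residual_orthogonal:
  fixes A :: "real^'k::finite^'n::finite"
  assumes "invertible (transpose A ** A)"
  shows "((mat 1 - col_proj A) *v b) \<bullet> (A *v c) = 0"
proof -
  have "transpose A ** col_proj A = transpose A"
    using matrix_inv_invertible(1)[OF assms]
    by (simp add: col_proj_def matrix_mul_assoc matrix_mul_lid)
  then have "transpose A *v ((mat 1 - col_proj A) *v b) = 0"
    by (simp add: matrix_vector_mult_diff_rdistrib matrix_vector_mult_diff_distrib
        matrix_vector_mul_assoc)
  then show ?thesis
    by (simp flip: dot_lmul_matrix)
qed

lemma col_proj_in_range: "col_proj A *v b \<in> range ((*v) A)"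
  unfolding col_proj_def by (simp add: matrix_vector_mul_assoc[symmetric])

lemma inj_on_col_space:
  fixes X :: "real^'p::finite^'n::finite"
  assumes card: "CARD('k::finite) = card F"
    and inv: "invertible (transpose (cols_at X F :: real^'k^'n) ** (cols_at X F :: real^'k^'n))"
  shows "inj_on ((*v) X) {\<theta>. supp_vec \<theta> \<subseteq> F}"
proof (rule inj_onI)
  fix \<theta> \<theta>' assume *: "\<theta> \<in> {\<theta>. supp_vec \<theta> \<subseteq> F}" "\<theta>' \<in> {\<theta>. supp_vec \<theta> \<subseteq> F}" "X *v \<theta> = X *v \<theta>'"
  have "(entries_at \<theta> F :: real^'k) = entries_at \<theta>' F"
    using * cols_at_mult_entries_at_supp[OF card, of \<theta> X] cols_at_mult_entries_at_supp[OF card, of \<theta>' X]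
    by (intro injD[OF inj_if_invertible_gram[OF inv]]) simp
  moreover have "range (enum_of F :: 'k \<Rightarrow> 'p) = F"
    using bij_betw_enum_of[OF card] by (auto simp: bij_betw_def)
  ultimately have "\<theta> $ i = \<theta>' $ i" if "i \<in> F" for i
    using that by (force simp: entries_at_def vec_eq_iff)
  moreover have "\<theta> $ i = 0" "\<theta>' $ i = 0" if "i \<notin> F" for i
    using * that by (auto simp: supp_vec_def)
  ultimately show "\<theta> = \<theta>'"
    by (metis vec_eq_iff)
qed

text \<open>Injectivity over \<open>F\<close> passes to every \<open>S\<close> inside it, so one
  Gram condition gives the dimensions for both \<open>F\<close> and
  \<open>T \<inter> F\<close>.\<close>

lemma dim_col_space:
  fixes X :: "real^'p::finite^'n::finite"
  assumes "inj_on ((*v) X) {\<theta>. supp_vec \<theta> \<subseteq> F}" "S \<subseteq> F"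
  shows "dim (col_space X S) = card S"
proof -
  have "inj_on ((*v) X) (span {\<theta>. supp_vec \<theta> \<subseteq> S})"
    unfolding span_eq_iff[THEN iffD2, OF subspace_supp_vec]
    by (rule inj_on_subset[OF assms(1)]) (use assms(2) in auto)
  then have "dim (col_space X S) = dim {\<theta> :: real^'p. supp_vec \<theta> \<subseteq> S}"
    unfolding col_space_def by (intro dim_image_eq matrix_vector_mul_linear)
  also have "{\<theta> :: real^'p. supp_vec \<theta> \<subseteq> S} = {\<theta>. \<forall>i. i \<notin> S \<longrightarrow> \<theta> $ i = 0}"
    by (auto simp: supp_vec_def)
  finally show ?thesis
    by (simp add: dim_substandard_cart flip: dim_vec_eq)
qed

section \<open>Deterministic inequality on the error event\<close>

text \<open>Split \<open>z = a + p + q\<close> with \<open>a\<close> in the column space of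
  \<open>T \<inter> F\<close>, \<open>p\<close> in the range of \<open>U\<close> and
  \<open>q\<close> orthogonal to the column space of \<open>F\<close>. The competitor
  \<open>\<beta> + \<tau>\<close> absorbs \<open>a\<close> and has residual \<open>p + q\<close>,
  while a vector supported in \<open>F\<close> has a residual at least as long as
  \<open>w + q\<close>. The squares of \<open>q\<close> cancel on comparison.\<close>

lemma sparse_ls_error_bound:
  fixes X :: "real^'p::finite^'n::finite" and U :: "real^'d::finite \<Rightarrow> real^'n"
  assumes ls: "sparse_ls X k (X *v \<beta> + z) \<theta>" "supp_vec \<theta> \<subseteq> F"
    and \<beta>: "supp_vec \<beta> \<subseteq> T" "card T \<le> k"
    and w: "\<And>x. x \<in> col_space X F \<Longrightarrow> w \<bullet> x = 0" "X *v \<beta> - w \<in> col_space X F"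
    and U: "linear U" "\<And>g. norm (U g) = norm g"
      "range U = {p \<in> col_space X F. \<forall>x\<in>col_space X (T \<inter> F). orthogonal x p}"
  shows "(norm w)\<^sup>2 + 2 * (w \<bullet> z) \<le> (norm (adjoint U z))\<^sup>2"
proof -
  note sub = subspace_col_space[of X F]
  obtain b q where b: "b \<in> col_space X F" and q: "\<And>x. x \<in> col_space X F \<Longrightarrow> q \<bullet> x = 0"
    and z: "z = b + q"
    by (rule orthogonal_decomp_subspace[OF sub, where a = z]) blast
  obtain a p where a: "a \<in> col_space X (T \<inter> F)" and p: "\<And>x. x \<in> col_space X (T \<inter> F) \<Longrightarrow> p \<bullet> x = 0"
    and ap: "b = a + p"
    by (rule orthogonal_decomp_subspace[OF subspace_col_space, where a = b]) blast
  have aF: "a \<in> col_space X F"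
    using a col_space_mono[of "T \<inter> F" F X] by auto
  have pF: "p \<in> col_space X F"
    using subspace_diff[OF sub b aF] ap by simp
  then have "p \<in> range U"
    unfolding U(3) using p by (auto simp: orthogonal_def inner_commute)
  then obtain h where h: "p = U h"
    by auto
  obtain \<tau> where \<tau>: "supp_vec \<tau> \<subseteq> T \<inter> F" "a = X *v \<tau>"
    using a by (auto simp: col_space_def)
  have "supp_vec (\<beta> + \<tau>) \<subseteq> T"
    using subspace_add[OF subspace_supp_vec[of T], of \<beta> \<tau>] \<tau>(1) \<beta>(1) by auto
  then have "card (supp_vec (\<beta> + \<tau>)) \<le> k"
    using \<beta>(2) card_mono[OF finite] order_trans by blast
  then have "norm (X *v \<beta> + z - X *v \<theta>) \<le> norm (X *v \<beta> + z - X *v (\<beta> + \<tau>))"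
    using ls(1) unfolding sparse_ls_def by blast
  also have "X *v \<beta> + z - X *v (\<beta> + \<tau>) = p + q"
    using z ap \<tau>(2) by (simp add: matrix_vector_right_distrib)
  finally have le: "(norm (X *v \<beta> + z - X *v \<theta>))\<^sup>2 \<le> (norm (p + q))\<^sup>2"
    by (rule power_mono) simp
  define c where "c = (X *v \<beta> - w) + b - X *v \<theta>"
  have c: "c \<in> col_space X F"
    unfolding c_def
    by (intro subspace_diff[OF sub] subspace_add[OF sub] w(2) b mult_vec_in_col_space ls(2))
  have "X *v \<beta> + z - X *v \<theta> = (w + q) + c"
    by (simp add: c_def z)
  then have "(norm (X *v \<beta> + z - X *v \<theta>))\<^sup>2 = (norm w)\<^sup>2 + 2 * (w \<bullet> q) + (norm q)\<^sup>2 + (norm c)\<^sup>2"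
    using w(1)[OF c] q[OF c]
    by (simp add: power2_norm_eq_inner inner_add_left inner_add_right inner_commute)
  moreover have "(norm (p + q))\<^sup>2 = (norm p)\<^sup>2 + (norm q)\<^sup>2"
    using q[OF pF] by (simp add: power2_norm_eq_inner inner_add_left inner_add_right inner_commute)
  moreover have "w \<bullet> q = w \<bullet> z"
    using w(1)[OF b] by (simp add: z inner_add_right)
  ultimately have "(norm w)\<^sup>2 + 2 * (w \<bullet> z) \<le> (norm p)\<^sup>2"
    using le zero_le_power2[of "norm c"] by linarith
  also have "(norm p)\<^sup>2 \<le> (norm (adjoint U z))\<^sup>2"
  proof (rule power_mono)
    \<comment> \<open>Both \<open>a\<close> and \<open>q\<close> are orthogonal to \<open>p\<close>,
      so pairing with \<open>z\<close> sees only \<open>p\<close>. Cauchy-Schwarz then applies to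
      \<open>h\<close>, which has the norm of \<open>p\<close>.\<close>
    have "(norm p)\<^sup>2 = z \<bullet> U h"
      using q[OF pF] p[OF a]
      by (simp add: power2_norm_eq_inner z ap inner_add_left inner_add_right inner_commute flip: h)
    also have "\<dots> = adjoint U z \<bullet> h"
      by (simp add: adjoint_clauses[OF U(1)])
    also have "\<dots> \<le> norm (adjoint U z) * norm p"
      using norm_cauchy_schwarz[of "adjoint U z" h] by (simp add: h U(2))
    finally show "norm p \<le> norm (adjoint U z)"
      by (cases "p = 0") (auto simp: power2_eq_square)
  qed simp
  finally show ?thesis .
qed

text \<open>Comparing the coefficients, \<open>(3 - 2 * sqrt 2) / 2 \<le> 1 / 8\<close> amounts to
  \<open>11 / 8 \<le> sqrt 2\<close>, and \<open>sqrt 2 \<le> exp (1 / 2)\<close> amounts to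
  \<open>2 \<le> exp 1\<close>.\<close>

lemma exp_bound_constants:
  fixes x :: real
  assumes "x \<ge> 0"
  shows "exp (- x / 8) * sqrt 2 ^ d \<le> exp (- ((3 - 2 * sqrt 2) / 2) * x + real d / 2)"
proof -
  have "11 / 8 \<le> sqrt 2"
    by (rule real_le_rsqrt) (simp add: power2_eq_square)
  then have "(3 - 2 * sqrt 2) / 2 * x \<le> 1 / 8 * x"
    using assms by (intro mult_right_mono) auto
  then have "exp (- x / 8) \<le> exp (- ((3 - 2 * sqrt 2) / 2) * x)"
    by simp
  moreover have "sqrt 2 ^ d \<le> exp (real d / 2)"
  proof -
    have "sqrt 2 \<le> exp (1 / 2 :: real)"
      using exp_ge_add_one_self[of "1::real"]
      by (intro real_le_lsqrt) (auto simp flip: exp_of_nat_mult)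
    then have "sqrt 2 ^ d \<le> exp (1 / 2) ^ d"
      by (intro power_mono) auto
    then show ?thesis
      by (simp flip: exp_of_nat_mult)
  qed
  ultimately show ?thesis
    unfolding exp_add by (intro mult_mono) auto
qed

section \<open>Probability of declaring \<open>F\<close>\<close>

theorem theorem1:
  fixes M :: "'w measure"
    and X :: "real^'p::finite^'n::finite"
    and T F :: "'p set"
    and \<beta> :: "real^'p"
    and \<epsilon> y :: "'w \<Rightarrow> real^'n"
    and bhat :: "real^'n \<Rightarrow> real^'p"
    and k d :: nat
  assumes "prob_space M"
    and "card T = k"
    and "supp_vec \<beta> = T"
    and "distributed M lborel \<epsilon> std_normal_vec_density"
    and "\<And>\<omega>. \<omega> \<in> space M \<Longrightarrow> y \<omega> = X *v \<beta> + \<epsilon> \<omega>"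
    and "l0_decoder X k bhat"
    and "card F = k"
    and "F \<noteq> T"
    and "card (T - F) = d"
    and "CARD('k::finite) = k"
    and "CARD('d::finite) = d"
    and "invertible (transpose (cols_at X F :: real^'k^'n) ** (cols_at X F :: real^'k^'n))"
  shows "measure M {\<omega> \<in> space M. supp_vec (bhat (y \<omega>)) = F}
    \<le> exp (- ((3 - 2 * sqrt 2) / 2)
             * (norm ((mat 1 - col_proj (cols_at X F :: real^'k^'n))
                 *v ((cols_at X (T - F) :: real^'d^'n) *v entries_at \<beta> (T - F))))\<^sup>2
           + real d / 2)"
proof -
  interpret prob_space M by fact
  note dist = assms(4)
  have cardF: "CARD('k) = card F" and cardTF: "CARD('d) = card (T - F)"
    using assms by simp_all
  note inv = assms(12)
  define s where "s = (cols_at X (T - F) :: real^'d^'n) *v entries_at \<beta> (T - F)"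
  define w where "w = (mat 1 - col_proj (cols_at X F :: real^'k^'n)) *v s"
  have w_orth: "w \<bullet> x = 0" if "x \<in> col_space X F" for x
    using that col_proj_residual_orthogonal[OF inv]
    unfolding w_def by (auto simp flip: range_cols_at[OF cardF])
  \<comment> \<open>\<open>w\<close> is built from the columns in \<open>T - F\<close> only. The
    contribution of \<open>T \<inter> F\<close> and the projection of \<open>s\<close> both lie in
    the column space of \<open>F\<close>, so \<open>w\<close> is also the orthogonal component of
    the full mean \<open>X *v \<beta>\<close>.\<close>
  have w_diff: "X *v \<beta> - w \<in> col_space X F"
  proof -
    have "X *v \<beta> = (\<Sum>j\<in>T. \<beta> $ j *\<^sub>R column j X)"
      unfolding matrix_mult_sum scalar_mult_eq_scaleR
      by (rule sum.mono_neutral_right) (use assms(3) in \<open>auto simp: supp_vec_def\<close>)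
    also have "\<dots> = s + (\<Sum>j\<in>T \<inter> F. \<beta> $ j *\<^sub>R column j X)"
      unfolding s_def cols_at_mult_entries_at[OF cardTF]
      by (subst sum.union_disjoint[symmetric]) (auto intro: sum.cong)
    finally have "X *v \<beta> - w = (\<Sum>j\<in>T \<inter> F. \<beta> $ j *\<^sub>R column j X)
        + col_proj (cols_at X F :: real^'k^'n) *v s"
      by (simp add: w_def matrix_vector_mult_diff_rdistrib)
    also have "\<dots> \<in> col_space X F"
      using col_proj_in_range[of "cols_at X F :: real^'k^'n" s] unfolding range_cols_at[OF cardF]
      by (intro subspace_add subspace_sum subspace_mul subspace_col_space column_in_col_space) auto
    finally show ?thesis .
  qed
  \<comment> \<open>Its dimension is \<open>card F - card (T \<inter> F)\<close>, which equals
    \<open>d\<close> because \<open>card F = card T\<close>; hence \<open>real^'d\<close> maps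
    isometrically onto it.\<close>
  let ?W = "{p \<in> col_space X F. \<forall>x\<in>col_space X (T \<inter> F). orthogonal x p}"
  have "dim ?W + card (T \<inter> F) = card F"
    using dim_subspace_orthogonal_to_vectors[OF subspace_col_space subspace_col_space
        col_space_mono[of "T \<inter> F" F X]] dim_col_space[OF inj_on_col_space[OF cardF inv]]
    by simp
  moreover have "card (T \<inter> F) + card (T - F) = card T"
    by (subst card_Un_disjoint[symmetric]) (auto intro: arg_cong[where f = card])
  ultimately have dim_W: "dim (UNIV :: (real^'d) set) = dim ?W"
    using assms by simp
  have subspace_W: "subspace ?W"
    using subspace_col_space[of X F]
    by (auto simp: subspace_def orthogonal_def inner_add_right)
  obtain U :: "real^'d \<Rightarrow> real^'n"
    where U: "linear U" "\<And>g. norm (U g) = norm g" "range U = ?W"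
    by (rule isometries_subspaces[OF subspace_UNIV subspace_W dim_W]) auto
  have w_U: "w \<bullet> U g = 0" for g
    using U(3) by (intro w_orth) auto
  \<comment> \<open>This is the Chernoff weight: the error inequality makes the exponent
    nonnegative, so the weight is at least 1 on the event.\<close>
  define h where "h z = ennreal (exp (((norm (adjoint U z))\<^sup>2 - (norm w)\<^sup>2 - 2 * (w \<bullet> z)) / 4))" for z
  have "linear (adjoint U)"
    using U(1) by (rule adjoint_linear)
  then have [measurable]: "adjoint U \<in> borel_measurable borel"
    by (intro borel_measurable_continuous_onI linear_continuous_on)
       (simp add: linear_conv_bounded_linear)
  have [measurable]: "h \<in> borel_measurable borel"
    unfolding h_def[abs_def] by measurable
  have [measurable]: "\<epsilon> \<in> borel_measurable M"
    using distributed_measurable[OF dist] by simp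
  let ?E = "{\<omega> \<in> space M. supp_vec (bhat (y \<omega>)) = F}"
  have kp: "k \<le> CARD('p)"
    using assms(7) card_mono[of UNIV F] by auto
  \<comment> \<open>The law of \<open>\<epsilon>\<close> has a density with respect to
    \<open>lborel\<close>, so the exceptional null set of noise values stays null.\<close>
  have "AE z in distr M lborel \<epsilon>. \<exists>\<theta>. sparse_ls X k (X *v \<beta> + z) \<theta> \<and> card (supp_vec \<theta>) = k"
    unfolding distributed_distr_eq_density[OF dist]
    using AE_sparse_ls_full_support[OF kp, of X "X *v \<beta>"]
    by (subst AE_density) auto
  then have "AE \<omega> in M. \<exists>\<theta>. sparse_ls X k (X *v \<beta> + \<epsilon> \<omega>) \<theta> \<and> card (supp_vec \<theta>) = k"
    by (rule AE_distrD[rotated]) simp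
  then have AE: "AE \<omega> in M. indicator ?E \<omega> \<le> h (\<epsilon> \<omega>)"
    using AE_space
  proof eventually_elim
    case (elim \<omega>)
    then have ls: "sparse_ls X k (X *v \<beta> + \<epsilon> \<omega>) (bhat (y \<omega>))"
      using sparse_ls_decoder[OF _ _ assms(6)] assms(5) by metis
    show ?case
    proof (cases "\<omega> \<in> ?E")
      case True
      then have "(norm w)\<^sup>2 + 2 * (w \<bullet> \<epsilon> \<omega>) \<le> (norm (adjoint U (\<epsilon> \<omega>)))\<^sup>2"
        by (intro sparse_ls_error_bound[OF ls _ _ _ w_orth w_diff U]) (use assms in auto)
      then show ?thesis
        using True by (simp add: h_def)
    qed simp
  qed
  have "emeasure M ?E \<le> (\<integral>\<^sup>+ \<omega>. h (\<epsilon> \<omega>) \<partial>M)"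
  \<comment> \<open>A nonmeasurable set has \<open>emeasure\<close> 0 by convention, so that case is
    immediate.\<close>
  proof (cases "?E \<in> sets M")
    case True
    then show ?thesis
      using nn_integral_mono_AE[OF AE] by simp
  qed (simp add: emeasure_notin_sets)
  also have "\<dots> = (\<integral>\<^sup>+ z. ennreal (std_normal_vec_density z) * h z \<partial>lborel)"
    by (rule distributed_nn_integral[OF dist, symmetric]) simp
  also have "\<dots> = ennreal (exp (- (norm w)\<^sup>2 / 8) * sqrt 2 ^ d)"
    unfolding h_def using std_normal_vec_exp_projection[OF U(1,2) w_U] assms by simp
  also have "\<dots> \<le> ennreal (exp (- ((3 - 2 * sqrt 2) / 2) * (norm w)\<^sup>2 + real d / 2))"
    by (intro ennreal_leI exp_bound_constants) simp
  finally show ?thesis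
    unfolding w_def s_def by (simp add: emeasure_eq_measure)
qed

end
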